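(* The set of $\varphi$-practical numbers has asymptotic density $0$; that is, $$\lim_{x\to\infty}\frac{\#\{n\le x : n \text{ is } \varphi\text{-practical}\}}{x}=0.$$
   Context: $\varphi$ denotes Euler's totient function. A positive integer $n$ is called $\varphi$-practical if every integer $m$ with $1\le m\le n$ can be written as $m=\sum_{d\in\mathcal D}\varphi(d)$ for some subset $\mathcal D$ of the set of positive divisors of $n$. Equivalently, the polynomial $t^n-1$ has a divisor in $\mathbb Z[t]$ of every degree $m$ with $1\le m\le n$. *)

theory Defs
  imports Complex_Main "HOL-Number_Theory.Totient"
begin

definition phi_practical :: "nat \<Rightarrow> bool" where
  "phi_practical n \<longleftrightarrow>
     n > 0 \<and> (\<forall>m\<in>{1..n}. \<exists>D\<subseteq>{d. d dvd n}. m = (\<Sum>d\<in>D. totient d))"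

end

theory Submission
  imports Defs "HOL-Analysis.Harmonic_Numbers" "HOL-Real_Asymp.Real_Asymp"
begin

text \<open>
  Subset sums of the totients of the divisors of \<open>n\<close> take at most \<open>2 ^ \<tau>(n)\<close> values, so a
  \<open>\<phi>\<close>-practical \<open>n\<close> satisfies \<open>\<tau>(n) \<ge> log\<^sub>2 n\<close>. This fails for almost all \<open>n\<close>: for a finite set
  \<open>S\<close> of primes let \<open>w(n)\<close> be \<open>3/2\<close> to the number of \<open>p \<in> S\<close> dividing \<open>n\<close>. Then
  \<open>\<Sum>\<^sub>n\<^sub>\<le>\<^sub>x w(n) \<sim> A x\<close> and \<open>\<Sum>\<^sub>n\<^sub>\<le>\<^sub>x \<tau>(n) / w(n) \<sim> C x ln x\<close>, and weighting the two terms
  suitably bounds the upper density of \<open>{n. \<tau>(n) \<ge> log\<^sub>2 n}\<close> by a constant multiple of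
  \<open>sqrt (A C)\<close>. Here \<open>A C\<close> is a product over \<open>p \<in> S\<close> of factors \<open>1 - 1/(6p) + 1/(6p\<^sup>3)\<close>, which
  tends to \<open>0\<close> as \<open>S\<close> grows because \<open>\<Prod>(1 - 1/p)\<close> diverges to \<open>0\<close>.
\<close>

section \<open>Summatory functions and divisibility by a fixed number\<close>

text \<open>The cutoff is real because the recursions below evaluate these sums at
  \<open>x / p\<close> and \<open>x / p / p\<close>.\<close>

definition summatory :: "(nat \<Rightarrow> real) \<Rightarrow> real \<Rightarrow> real" where
  "summatory f x = (\<Sum>n | 0 < n \<and> real n \<le> x. f n)"

lemma finite_pos_le_real [simp]: "finite {n::nat. 0 < n \<and> real n \<le> x}"
  by (rule finite_subset[of _ "{..nat \<lceil>x\<rceil>}"]) (auto, linarith)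

lemma card_pos_le_real:
  assumes "x \<ge> 0"
  shows "card {n::nat. 0 < n \<and> real n \<le> x} = nat \<lfloor>x\<rfloor>"
proof -
  have "{n::nat. 0 < n \<and> real n \<le> x} = {1..nat \<lfloor>x\<rfloor>}"
    using assms by (auto simp: le_nat_iff le_floor_iff)
  then show ?thesis by simp
qed

lemma summatory_multiples:
  fixes d :: nat
  assumes "d > 0"
  shows "summatory (\<lambda>n. if d dvd n then f n else 0) x = summatory (\<lambda>m. f (d * m)) (x / d)"
proof -
  have "summatory (\<lambda>n. if d dvd n then f n else 0) x
      = (\<Sum>n\<in>{n. 0 < n \<and> real n \<le> x} \<inter> {n. d dvd n}. f n)"
    unfolding summatory_def by (simp add: sum.inter_restrict)
  also have "\<dots> = summatory (\<lambda>m. f (d * m)) (x / d)"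
    unfolding summatory_def
    by (rule sum.reindex_bij_witness[of _ "\<lambda>m. d * m" "\<lambda>n. n div d"])
       (use assms in \<open>auto simp: field_simps elim!: dvdE\<close>)
  finally show ?thesis .
qed

section \<open>The divisor function at a prime multiple\<close>

abbreviation tau :: "nat \<Rightarrow> nat" where
  "tau n \<equiv> card {d. d dvd n}"

text \<open>Inclusion-exclusion: the divisors of \<open>p * m\<close> are those of \<open>m\<close>
  together with their \<open>p\<close>-multiples. The overlap is \<open>p\<close> times the divisors
  of \<open>m div p\<close>, or empty. The additive form avoids truncated subtraction.\<close>

lemma tau_prime_mult:
  assumes p: "prime p" and m: "m > 0"
  shows "tau (p * m) + (if p dvd m then tau (m div p) else 0) = 2 * tau m"
proof -
  let ?D = "\<lambda>n. {d::nat. d dvd n}"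
  have p0: "p > 0" using p prime_gt_0_nat by blast
  have fin: "finite (?D m)" using m by simp
  have un: "?D (p * m) = ?D m \<union> (*) p ` ?D m"
  proof safe
    fix d assume d: "d dvd p * m" "d \<notin> (*) p ` ?D m"
    show "d dvd m"
    proof (cases "p dvd d")
      case True
      then obtain e where "d = p * e" by blast
      then show ?thesis using d p0 by auto
    next
      case False
      then have "coprime d p" using p prime_imp_coprime coprime_commute by blast
      then show ?thesis using d by (simp add: coprime_dvd_mult_right_iff)
    qed
  qed auto
  have inj: "inj_on ((*) p) X" for X using p0 by (simp add: inj_on_def)
  have int: "card (?D m \<inter> (*) p ` ?D m) = (if p dvd m then tau (m div p) else 0)"
  proof (cases "p dvd m")
    case True
    then obtain k where k: "m = p * k" by blast
    have "?D m \<inter> (*) p ` ?D m = (*) p ` ?D k" using p0 by (auto simp: k)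
    then show ?thesis using True p0 inj by (simp add: k card_image)
  next
    case False
    then have "?D m \<inter> (*) p ` ?D m = {}" by (auto dest: dvd_mult_left)
    then show ?thesis using False by simp
  qed
  have "card (?D m) + card ((*) p ` ?D m) = tau (p * m) + card (?D m \<inter> (*) p ` ?D m)"
    unfolding un by (rule card_Un_Int) (use fin in auto)
  then show ?thesis using int inj by (simp add: card_image)
qed

section \<open>Weights on a finite set of primes and their recursions\<close>

text \<open>The parameter \<open>c\<close> stays general so that one induction on \<open>S\<close>
  serves both 3/2 and its inverse 2/3.\<close>

definition weight :: "real \<Rightarrow> nat set \<Rightarrow> nat \<Rightarrow> real" where
  "weight c S n = (\<Prod>p\<in>S. if p dvd n then c else 1)"

lemma weight_nonneg: "c \<ge> 0 \<Longrightarrow> weight c S n \<ge> 0"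
  unfolding weight_def by (intro prod_nonneg) auto

lemma weight_inverse: "c * d = 1 \<Longrightarrow> weight c S n * weight d S n = 1"
  unfolding weight_def prod.distrib[symmetric] by (intro prod.neutral) auto

text \<open>A new prime \<open>p\<close> is invisible to the old weight, so the substitution
  \<open>n = p * m\<close> leads back to the same weight.\<close>

lemma weight_prime_mult:
  assumes "prime p" "p \<notin> S" "\<And>q. q \<in> S \<Longrightarrow> prime q"
  shows "weight c S (p * n) = weight c S n"
  unfolding weight_def
proof (intro prod.cong refl)
  fix q assume "q \<in> S"
  then have "q dvd p * n \<longleftrightarrow> q dvd n"
    using assms by (metis prime_dvd_mult_iff primes_dvd_imp_eq)
  then show "(if q dvd p * n then c else 1) = (if q dvd n then c else 1)" by simp
qed

lemma weight_insert:
  assumes "finite S" "p \<notin> S"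
  shows "weight c (insert p S) n = weight c S n + (c - 1) * (if p dvd n then weight c S n else 0)"
  using assms by (simp add: weight_def algebra_simps)

lemma summatory_weight_insert:
  assumes "finite S" "p \<notin> S" "prime p" "\<And>q. q \<in> S \<Longrightarrow> prime q"
  shows "summatory (weight c (insert p S)) x
       = summatory (weight c S) x + (c - 1) * summatory (weight c S) (x / p)"
proof -
  have "summatory (weight c (insert p S)) x
      = summatory (weight c S) x + (c - 1) * summatory (\<lambda>n. if p dvd n then weight c S n else 0) x"
    using assms by (simp add: summatory_def weight_insert sum.distrib sum_distrib_left)
  then show ?thesis
    using assms by (simp add: summatory_multiples prime_gt_0_nat weight_prime_mult)
qed

text \<open>Inserting \<open>p\<close> adds \<open>c - 1\<close> times the sum over multiples of
  \<open>p\<close>. There \<open>tau (p * m)\<close> is twice \<open>tau m\<close>, corrected by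
  \<open>tau (m div p)\<close> when \<open>p\<close> divides \<open>m\<close>; this correction
  yields the term at \<open>x / p / p\<close>.\<close>

lemma summatory_tau_weight_insert:
  fixes c :: real and S :: "nat set"
  assumes S: "finite S" "p \<notin> S" "prime p" "\<And>q. q \<in> S \<Longrightarrow> prime q"
  defines "T \<equiv> summatory (\<lambda>n. tau n * weight c S n)"
  shows "summatory (\<lambda>n. tau n * weight c (insert p S) n) x
       = T x + (c - 1) * (2 * T (x / p) - T (x / p / p))"
proof -
  let ?f = "\<lambda>n. real (tau n) * weight c S n"
  have p0: "p > 0" using S prime_gt_0_nat by blast
  have "summatory (\<lambda>n. tau n * weight c (insert p S) n) x
      = T x + (c - 1) * summatory (\<lambda>n. if p dvd n then ?f n else 0) x"
    unfolding T_def summatory_def sum_distrib_left sum.distrib[symmetric]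
    using S by (intro sum.cong) (auto simp: weight_insert algebra_simps)
  also have "summatory (\<lambda>n. if p dvd n then ?f n else 0) x = summatory (\<lambda>m. ?f (p * m)) (x / p)"
    using p0 by (rule summatory_multiples)
  also have "\<dots> = summatory (\<lambda>m. 2 * ?f m - (if p dvd m then tau (m div p) * weight c S m else 0)) (x / p)"
    unfolding summatory_def
  proof (intro sum.cong refl)
    fix m assume "m \<in> {n. 0 < n \<and> real n \<le> x / real p}"
    then have "real (tau (p * m)) = 2 * real (tau m) - (if p dvd m then real (tau (m div p)) else 0)"
      using tau_prime_mult[of p m] S by (auto split: if_splits)
    then show "?f (p * m) = 2 * ?f m - (if p dvd m then tau (m div p) * weight c S m else 0)"
      using S by (simp add: weight_prime_mult[of p S c m] left_diff_distrib)
  qed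
  also have "\<dots> = 2 * T (x / p) - summatory (\<lambda>m. if p dvd m then tau (m div p) * weight c S m else 0) (x / p)"
    by (simp add: T_def summatory_def sum_subtractf sum_distrib_left)
  also have "summatory (\<lambda>m. if p dvd m then tau (m div p) * weight c S m else 0) (x / p) = T (x / p / p)"
    using p0 S by (simp add: summatory_multiples weight_prime_mult T_def)
  finally show ?thesis .
qed

section \<open>Mean value of the weight\<close>

text \<open>Induction on \<open>S\<close>: the sum at \<open>x / p\<close> is asymptotically 1/p of
  the sum at \<open>x\<close>, so each prime contributes its own factor.\<close>

lemma summatory_weight_asymp:
  assumes "finite S" "\<And>p. p \<in> S \<Longrightarrow> prime p"
  shows "((\<lambda>x. summatory (weight c S) x / x) \<longlongrightarrow> (\<Prod>p\<in>S. 1 + (c - 1) / real p)) at_top"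
  using assms
proof (induction S rule: finite_induct)
  case empty
  have "eventually (\<lambda>x::real. summatory (weight c {}) x / x = of_int \<lfloor>x\<rfloor> / x) at_top"
    using eventually_ge_at_top[of 0]
    by eventually_elim (simp add: summatory_def weight_def card_pos_le_real)
  moreover have "((\<lambda>x::real. of_int \<lfloor>x\<rfloor> / x) \<longlongrightarrow> 1) at_top" by real_asymp
  ultimately have "((\<lambda>x. summatory (weight c {}) x / x) \<longlongrightarrow> 1) at_top"
    by (simp only: tendsto_cong)
  then show ?case by simp
next
  case (insert p S)
  let ?G = "summatory (weight c S)" and ?A = "\<Prod>p\<in>S. 1 + (c - 1) / real p"
  have p0: "real p > 0" using insert.prems prime_gt_0_nat by simp
  have G: "((\<lambda>x. ?G x / x) \<longlongrightarrow> ?A) at_top" using insert by auto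
  have "filterlim (\<lambda>x::real. x / p) at_top at_top" using p0 by real_asymp
  from filterlim_compose[OF G this]
  have "((\<lambda>x. ?G x / x + (c - 1) / p * (?G (x / p) / (x / p))) \<longlongrightarrow> ?A + (c - 1) / p * ?A) at_top"
    by (intro tendsto_intros G)
  moreover have "?G x / x + (c - 1) / p * (?G (x / p) / (x / p)) = summatory (weight c (insert p S)) x / x" for x
    using p0 insert by (simp add: summatory_weight_insert add_divide_distrib)
  ultimately show ?case using insert by (simp add: algebra_simps)
qed

section \<open>Average order of the divisor function, plain and weighted\<close>

text \<open>The difference \<open>harm n - ln n\<close> decreases from its value 1 at
  \<open>n = 1\<close>.\<close>

lemma harm_le_ln: "n > 0 \<Longrightarrow> harm n \<le> 1 + ln (real n)"
  using decseqD[OF decseq_harm_diff_ln, of 0 "n - 1"] by (simp add: harm_expand)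

text \<open>Swapping summation turns the sum into that of the floors of \<open>x / d\<close>.
  Dropping the floors gives \<open>x * harm N\<close>, at a cost of at most 1 for each of the
  \<open>N\<close> terms.\<close>

lemma summatory_tau_bounds:
  assumes "x \<ge> 1"
  shows "x * (ln x - 1) \<le> summatory (\<lambda>n. real (tau n)) x" (is ?lower)
    and "summatory (\<lambda>n. real (tau n)) x \<le> x * (ln x + 1)" (is ?upper)
proof -
  let ?I = "{n::nat. 0 < n \<and> real n \<le> x}"
  define N where "N = nat \<lfloor>x\<rfloor>"
  have N: "N > 0" "real N \<le> x" "x < real N + 1" using assms unfolding N_def by linarith+
  have I: "?I = {1..N}" using N by auto
  have harm: "(\<Sum>d\<in>?I. x / real d) = x * harm N"
    unfolding harm_def I by (simp add: sum_distrib_left divide_inverse)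
  have "summatory (\<lambda>n. real (tau n)) x = (\<Sum>n\<in>?I. \<Sum>d\<in>?I. if d dvd n then 1 else 0)"
    unfolding summatory_def
  proof (intro sum.cong refl)
    fix n assume n: "n \<in> ?I"
    have div: "{d. d dvd n} = {d\<in>?I. d dvd n}"
    proof safe
      fix d assume "d dvd n"
      with n show "0 < d" "real d \<le> x"
        using dvd_imp_le[of d n] by (auto intro: dvd_pos_nat)
    qed
    show "real (tau n) = (\<Sum>d\<in>?I. if d dvd n then 1 else 0)"
      unfolding sum.inter_filter[OF finite_pos_le_real, symmetric] div by simp
  qed
  also have "\<dots> = (\<Sum>d\<in>?I. \<Sum>n\<in>?I. if d dvd n then 1 else 0)" by (rule sum.swap)
  also have "\<dots> = (\<Sum>d\<in>?I. of_int \<lfloor>x / d\<rfloor>)"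
  proof (intro sum.cong refl)
    fix d assume "d \<in> ?I"
    then have "(\<Sum>n\<in>?I. if d dvd n then 1 else 0) = summatory (\<lambda>_. 1) (x / d)"
      using summatory_multiples[of d "\<lambda>_. 1" x] by (simp add: summatory_def)
    also have "\<dots> = of_int \<lfloor>x / d\<rfloor>"
      using assms by (simp add: summatory_def card_pos_le_real)
    finally show "(\<Sum>n\<in>?I. if d dvd n then 1 else 0) = real_of_int \<lfloor>x / d\<rfloor>" .
  qed
  finally have eq: "summatory (\<lambda>n. real (tau n)) x = (\<Sum>d\<in>?I. of_int \<lfloor>x / d\<rfloor>)" .
  \<comment> \<open>\<open>ln_le_harm\<close> bounds the logarithm of \<open>N + 1\<close>, which
    exceeds \<open>x\<close>.\<close>
  have "ln x \<le> harm N" using ln_le_harm[of N] N assms by (smt (verit) ln_mono)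
  then have "x * (ln x - 1) \<le> x * harm N - x" using assms by (simp add: algebra_simps)
  also have "\<dots> \<le> (\<Sum>d\<in>?I. x / real d - 1)"
    using N harm by (simp add: sum_subtractf I)
  also have "\<dots> \<le> (\<Sum>d\<in>?I. of_int \<lfloor>x / d\<rfloor>)" by (intro sum_mono) linarith
  finally show ?lower unfolding eq .
  have "(\<Sum>d\<in>?I. of_int \<lfloor>x / d\<rfloor>) \<le> (\<Sum>d\<in>?I. x / real d)" by (intro sum_mono) linarith
  also have "\<dots> \<le> x * (ln x + 1)"
    unfolding harm using harm_le_ln[of N] N assms
    by (intro mult_left_mono) (smt (verit) ln_mono of_nat_0_less_iff)+
  finally show ?upper unfolding eq .
qed

lemma summatory_tau_asymp: "((\<lambda>x. summatory (\<lambda>n. real (tau n)) x / (x * ln x)) \<longlongrightarrow> 1) at_top"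
proof (rule tendsto_sandwich)
  show "\<forall>\<^sub>F x in at_top. (x * (ln x - 1)) / (x * ln x) \<le> summatory (\<lambda>n. real (tau n)) x / (x * ln x)"
    using eventually_gt_at_top[of 1]
    by eventually_elim (intro divide_right_mono summatory_tau_bounds, auto)
  show "\<forall>\<^sub>F x in at_top. summatory (\<lambda>n. real (tau n)) x / (x * ln x) \<le> (x * (ln x + 1)) / (x * ln x)"
    using eventually_gt_at_top[of 1]
    by eventually_elim (intro divide_right_mono summatory_tau_bounds, auto)
qed real_asymp+

text \<open>Since \<open>ln (x / k)\<close> is asymptotic to \<open>ln x\<close>, only the linear
  factor feels the rescaling.\<close>

lemma tendsto_rescale_x_ln_x:
  fixes k :: real
  assumes "k > 0" and T: "((\<lambda>x. T x / (x * ln x)) \<longlongrightarrow> C) at_top"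
  shows "((\<lambda>x. T (x / k) / (x * ln x)) \<longlongrightarrow> C / k) at_top"
proof -
  have "filterlim (\<lambda>x::real. x / k) at_top at_top" using assms by real_asymp
  from filterlim_compose[OF T this]
  have "((\<lambda>x. T (x / k) / (x / k * ln (x / k)) * (x / k * ln (x / k) / (x * ln x))) \<longlongrightarrow> C * (1 / k)) at_top"
    by (rule tendsto_mult) (use assms in \<open>real_asymp simp: field_simps\<close>)
  moreover have "eventually (\<lambda>x. T (x / k) / (x / k * ln (x / k)) * (x / k * ln (x / k) / (x * ln x))
      = T (x / k) / (x * ln x)) at_top"
    \<comment> \<open>Beyond both 1 and \<open>k\<close>, neither \<open>ln x\<close> nor
      \<open>ln (x / k)\<close> vanishes.\<close>
    using eventually_gt_at_top[of "max 1 k"] by eventually_elim (use assms in auto)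
  ultimately have "((\<lambda>x. T (x / k) / (x * ln x)) \<longlongrightarrow> C * (1 / k)) at_top"
    by (rule Lim_transform_eventually)
  then show ?thesis by simp
qed

lemma summatory_tau_weight_asymp:
  assumes "finite S" "\<And>p. p \<in> S \<Longrightarrow> prime p"
  shows "((\<lambda>x. summatory (\<lambda>n. tau n * weight c S n) x / (x * ln x))
           \<longlongrightarrow> (\<Prod>p\<in>S. 1 + (c - 1) * (2 / real p - 1 / real p ^ 2))) at_top"
  using assms
proof (induction S rule: finite_induct)
  case empty
  show ?case using summatory_tau_asymp by (simp add: weight_def)
next
  case (insert p S)
  let ?T = "summatory (\<lambda>n. tau n * weight c S n)"
    and ?C = "\<Prod>p\<in>S. 1 + (c - 1) * (2 / real p - 1 / real p ^ 2)"
  have p0: "real p > 0" using insert.prems prime_gt_0_nat by simp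
  have T: "((\<lambda>x. ?T x / (x * ln x)) \<longlongrightarrow> ?C) at_top" using insert by auto
  have T1: "((\<lambda>x. ?T (x / p) / (x * ln x)) \<longlongrightarrow> ?C / p) at_top"
    by (rule tendsto_rescale_x_ln_x[OF p0 T])
  have T2: "((\<lambda>x. ?T (x / p / p) / (x * ln x)) \<longlongrightarrow> ?C / p / p) at_top"
    by (rule tendsto_rescale_x_ln_x[OF p0 T1])
  have "((\<lambda>x. ?T x / (x * ln x) + (c - 1) * (2 * (?T (x / p) / (x * ln x)) - ?T (x / p / p) / (x * ln x)))
      \<longlongrightarrow> ?C + (c - 1) * (2 * (?C / p) - ?C / p / p)) at_top"
    by (intro tendsto_intros T T1 T2)
  moreover have "summatory (\<lambda>n. tau n * weight c (insert p S) n) x / (x * ln x)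
      = ?T x / (x * ln x) + (c - 1) * (2 * (?T (x / p) / (x * ln x)) - ?T (x / p / p) / (x * ln x))" for x
    using summatory_tau_weight_insert[OF insert.hyps, of c x] insert.prems
    by (simp add: add_divide_distrib diff_divide_distrib right_diff_distrib)
  moreover have "?C + (c - 1) * (2 * (?C / p) - ?C / p / p)
      = (\<Prod>p\<in>insert p S. 1 + (c - 1) * (2 / real p - 1 / real p ^ 2))"
    using insert by (simp add: algebra_simps power2_eq_square)
  ultimately show ?case by simp
qed

section \<open>Divergence of the Euler product to 0\<close>

text \<open>One half of the Euler product formula, truncated at \<open>N\<close> to keep all sums
  finite. A number smooth over \<open>insert p S\<close> is either smooth over \<open>S\<close> or
  \<open>p\<close> times another such number, so the new sum \<open>s'\<close> and the old sum
  \<open>s\<close> satisfy \<open>s' <= s + s' / p\<close>.\<close>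

lemma sum_inverse_smooth_le:
  assumes "finite S" "\<And>p. p \<in> S \<Longrightarrow> prime p"
  shows "(\<Sum>n | 0 < n \<and> n \<le> N \<and> prime_factors n \<subseteq> S. 1 / real n) * (\<Prod>p\<in>S. 1 - 1 / real p) \<le> 1"
  using assms
proof (induction S rule: finite_induct)
  case empty
  have "{n. 0 < n \<and> n \<le> N \<and> prime_factors n \<subseteq> {}} \<subseteq> {1::nat}"
    by (auto simp: prime_factorization_empty_iff)
  then have "(\<Sum>n | 0 < n \<and> n \<le> N \<and> prime_factors n \<subseteq> {}. 1 / real n) \<le> (\<Sum>n\<in>{1}. 1 / real n)"
    by (intro sum_mono2) auto
  then show ?case by simp
next
  case (insert p S)
  let ?A = "\<lambda>S. {n. 0 < n \<and> n \<le> N \<and> prime_factors n \<subseteq> S}"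
  let ?s = "\<lambda>S. \<Sum>n\<in>?A S. 1 / real n"
  have p: "prime p" using insert by auto
  have p0: "p > 0" using p prime_gt_0_nat by blast
  have fin: "finite (?A S)" for S by (rule finite_subset[of _ "{..N}"]) auto
  have "?A (insert p S) \<subseteq> ?A S \<union> (*) p ` ?A (insert p S)"
  proof
    fix n assume n: "n \<in> ?A (insert p S)"
    show "n \<in> ?A S \<union> (*) p ` ?A (insert p S)"
    proof (cases "p dvd n")
      case True
      then obtain m where m: "n = p * m" by blast
      have pf: "prime_factors m \<subseteq> prime_factors n" using n by (intro dvd_prime_factors) (auto simp: m)
      have "m \<le> p * m" using p0 by simp
      moreover have "p * m \<le> N" using n m by blast
      ultimately have "m \<le> N" by (rule le_trans)
      then have "m \<in> ?A (insert p S)" using n pf by (auto simp: m)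
      then show ?thesis by (auto simp: m)
    qed (use n in \<open>auto simp: in_prime_factors_iff\<close>)
  qed
  then have "?s (insert p S) \<le> (\<Sum>n\<in>?A S \<union> (*) p ` ?A (insert p S). 1 / real n)"
    by (intro sum_mono2) (use fin in auto)
  also have "\<dots> \<le> ?s S + (\<Sum>n\<in>(*) p ` ?A (insert p S). 1 / real n)"
    \<comment> \<open>The sum over the union plus the nonnegative sum over the intersection equals
      the right-hand side.\<close>
    using fin by (subst sum.union_inter[symmetric]) (auto intro!: sum_nonneg)
  also have "(\<Sum>n\<in>(*) p ` ?A (insert p S). 1 / real n) = ?s (insert p S) / p"
    using p0 by (subst sum.reindex) (auto simp: inj_on_def sum_divide_distrib mult.commute)
  finally have "?s (insert p S) * (1 - 1 / p) \<le> ?s S" by (simp add: algebra_simps)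
  moreover have "(\<Prod>p\<in>S. 1 - 1 / real p) \<ge> 0"
    using insert.prems by (intro prod_nonneg) (auto dest!: prime_gt_0_nat simp: divide_le_eq)
  ultimately have "?s (insert p S) * (1 - 1 / p) * (\<Prod>p\<in>S. 1 - 1 / real p)
      \<le> ?s S * (\<Prod>p\<in>S. 1 - 1 / real p)" by (rule mult_right_mono)
  also have "\<dots> \<le> 1" using insert by auto
  finally show ?case using insert by (simp add: mult.assoc)
qed

text \<open>With \<open>S\<close> all primes up to \<open>N\<close>, every positive integer up to
  \<open>N\<close> is smooth over \<open>S\<close>, so the product is at most
  \<open>1 / harm N\<close>.\<close>

lemma ex_primes_prod_less:
  fixes e :: real
  assumes "e > 0"
  obtains S where "finite S" "\<And>p. p \<in> S \<Longrightarrow> prime (p::nat)" "(\<Prod>p\<in>S. 1 - 1 / real p) < e"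
proof -
  have "eventually (\<lambda>N. harm N > 1 / e) sequentially"
    using harm_at_top by (simp add: filterlim_at_top_dense)
  then obtain N where N: "harm N > 1 / e" by (auto simp: eventually_sequentially)
  define S where "S = {p. prime p \<and> p \<le> N}"
  have "{n. 0 < n \<and> n \<le> N \<and> prime_factors n \<subseteq> S} = {1..N}"
    by (auto simp: S_def in_prime_factors_iff, meson dvd_imp_le le_trans less_eq_Suc_le)
  then have sm: "(\<Sum>n | 0 < n \<and> n \<le> N \<and> prime_factors n \<subseteq> S. 1 / real n) = harm N"
    by (simp add: harm_def inverse_eq_divide)
  have fin: "finite S" by (rule finite_subset[of _ "{..N}"]) (auto simp: S_def)
  have "harm N * (\<Prod>p\<in>S. 1 - 1 / real p) \<le> 1"
    using sum_inverse_smooth_le[OF fin, of N] unfolding sm by (auto simp: S_def)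
  moreover have hN: "(harm N :: real) > 0" using N assms by (intro less_trans[OF _ N]) simp
  ultimately have "(\<Prod>p\<in>S. 1 - 1 / real p) \<le> 1 / harm N" by (simp add: field_simps)
  also have "\<dots> < e" using N assms hN by (simp add: field_simps)
  finally show ?thesis using that fin by (auto simp: S_def)
qed

section \<open>Smallness of the product of the two constants\<close>

text \<open>Used with \<open>u = 1 / p\<close>, to compare the factors with the divergent Euler
  product. The base is at most \<open>1 - u / 8\<close>; the exponent 16 turns this into a saving of
  about \<open>2 * u\<close>, leaving room for the claimed \<open>u\<close>.\<close>

lemma weight_factors_le:
  fixes u :: real
  assumes "0 < u" "u \<le> 1 / 2"
  shows "((1 + u / 2) * (1 - (2 * u - u ^ 2) / 3)) ^ 16 \<le> 1 - u"
proof -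
  have "u ^ 3 \<le> u / 4"
    using mult_left_mono[of "u ^ 2" "(1/2) ^ 2" u] power_mono[of u "1/2" 2] assms
    by (simp add: power2_eq_square power3_eq_cube)
  moreover have "(1 + u / 2) * (1 - (2 * u - u ^ 2) / 3) = 1 - u / 6 + u ^ 3 / 6"
    by (simp add: field_simps power2_eq_square power3_eq_cube)
  \<comment> \<open>The cubic term is at most \<open>u / 24\<close>, and 1/6 - 1/24 = 1/8.\<close>
  ultimately have le: "(1 + u / 2) * (1 - (2 * u - u ^ 2) / 3) \<le> 1 - u / 8" by simp
  have "u ^ 2 \<le> 1 * u" unfolding power2_eq_square using assms by (intro mult_right_mono) auto
  then have "0 \<le> (1 + u / 2) * (1 - (2 * u - u ^ 2) / 3)"
    using assms by (intro mult_nonneg_nonneg) (auto, smt (verit) zero_le_power2)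
  then have "((1 + u / 2) * (1 - (2 * u - u ^ 2) / 3)) ^ 16 \<le> (1 - u / 8) ^ 16"
    using le by (intro power_mono)
  also have "\<dots> \<le> 1 / (1 + 2 * u)"
  proof -
    have "(1 - u / 8) ^ 16 * (1 + 2 * u) \<le> (1 - u / 8) ^ 16 * (1 + u / 8) ^ 16"
      using Bernoulli_inequality[of "u / 8" 16] assms by (intro mult_left_mono) auto
    also have "\<dots> = (1 - (u / 8) ^ 2) ^ 16"
      by (simp add: power_mult_distrib[symmetric] algebra_simps power2_eq_square)
    also have "\<dots> \<le> 1"
      using assms by (intro power_le_one) (auto intro!: power_le_one)
    finally show ?thesis using assms by (simp add: field_simps)
  qed
  also have "\<dots> \<le> 1 - u"
    \<comment> \<open>\<open>(1 - u) * (1 + 2 * u) = 1 + u * (1 - 2 * u)\<close> is at least 1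
      because \<open>u\<close> is at most 1/2.\<close>
    using mult_left_mono[of u "1 / 2" u] assms by (simp add: field_simps)
  finally show ?thesis .
qed

lemma ex_primes_weight_product_less:
  fixes e :: real
  assumes "e > 0"
  obtains S where "finite S" "\<And>p. p \<in> S \<Longrightarrow> prime (p::nat)"
    "(\<Prod>p\<in>S. 1 + (3/2 - 1) / real p) * (\<Prod>p\<in>S. 1 + (2/3 - 1) * (2 / real p - 1 / real p ^ 2)) < e"
proof -
  obtain S where S: "finite S" "\<And>p. p \<in> S \<Longrightarrow> prime (p::nat)" "(\<Prod>p\<in>S. 1 - 1 / real p) < e ^ 16"
    using ex_primes_prod_less[of "e ^ 16"] assms by auto
  let ?f = "\<lambda>p. (1 + (3/2 - 1) / real p) * (1 + (2/3 - 1) * (2 / real p - 1 / real p ^ 2))"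
  have "(\<Prod>p\<in>S. ?f p) ^ 16 = (\<Prod>p\<in>S. ?f p ^ 16)" by (simp only: prod_power_distrib)
  also have "\<dots> \<le> (\<Prod>p\<in>S. 1 - 1 / real p)"
  \<comment> \<open>The exponent 16 is even, so nonnegativity needs no sign analysis of the
    factors.\<close>
  proof (intro prod_mono conjI)
    fix p assume "p \<in> S"
    then have "p \<ge> 2" using S prime_ge_2_nat by blast
    then have u: "0 < 1 / real p" "1 / real p \<le> 1 / 2" by (auto simp: field_simps)
    have "?f p = (1 + (1 / p) / 2) * (1 - (2 * (1 / p) - (1 / p) ^ 2) / 3)"
      by (simp add: field_simps power2_eq_square)
    then show "?f p ^ 16 \<le> 1 - 1 / real p" using weight_factors_le[OF u] by simp
  qed (simp add: zero_le_even_power)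
  finally have "(\<Prod>p\<in>S. ?f p) ^ 16 < e ^ 16" using S by simp
  then have "(\<Prod>p\<in>S. ?f p) < e" using power_less_imp_less_base less_imp_le[OF assms] by blast
  then show ?thesis using that S by (simp only: prod.distrib)
qed

section \<open>Counting phi-practical numbers by the weighted sums\<close>

lemma phi_practical_le_two_power_tau:
  assumes "phi_practical n"
  shows "n \<le> 2 ^ tau n"
proof -
  have n: "n > 0" using assms by (simp add: phi_practical_def)
  then have fin: "finite {d. d dvd n}" by simp
  have "{1..n} \<subseteq> (\<lambda>D. \<Sum>d\<in>D. totient d) ` Pow {d. d dvd n}"
    using assms by (force simp: phi_practical_def)
  then have "card {1..n} \<le> card (Pow {d. d dvd n})" using fin by (intro surj_card_le) auto
  then show ?thesis using fin by (simp add: card_Pow)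
qed

text \<open>Numbers up to \<open>sqrt x\<close> are counted trivially. A larger phi-practical
  \<open>n\<close> has \<open>ln n\<close> above \<open>ln x / 2\<close>, whence the factor 2 in the
  last term. The parameter \<open>l\<close> is left free to balance the two sums.\<close>

lemma card_phi_practical_le:
  assumes x: "x > 1" and l: "l > 0"
  shows "real (card {n. real n \<le> x \<and> phi_practical n})
    \<le> sqrt x + l * summatory (weight (3/2) S) x
        + 2 / (l * ln x) * summatory (\<lambda>n. tau n * weight (2/3) S n) x"
proof -
  let ?I = "{n::nat. 0 < n \<and> real n \<le> x}" and ?J = "{n::nat. 0 < n \<and> real n \<le> sqrt x}"
  let ?P = "{n. real n \<le> x \<and> phi_practical n}"
  let ?g = "\<lambda>n. l * weight (3/2) S n + 2 / (l * ln x) * (tau n * weight (2/3) S n)"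
  have lx: "ln x > 0" using x by simp
  have nn: "?g n \<ge> 0" for n
    using l lx by (intro add_nonneg_nonneg mult_nonneg_nonneg weight_nonneg divide_nonneg_nonneg) auto
  have sub: "?P \<subseteq> ?I" by (auto simp: phi_practical_def)
  have fin: "finite ?P" by (rule finite_subset[OF sub]) simp
  have g1: "1 \<le> ?g n" if n: "n \<in> ?P - ?J" for n
  proof -
    have n1: "sqrt x < real n" using n sub by auto
    have "ln x / 2 = ln (sqrt x)" using x by (simp add: ln_sqrt)
    also have "\<dots> \<le> ln (real n)" using n1 x by (intro ln_mono) auto
    also have "\<dots> \<le> ln (2 ^ tau n)"
    proof (intro ln_mono)
      show "real n \<le> 2 ^ tau n" using phi_practical_le_two_power_tau[of n] n
        by (metis (no_types, lifting) DiffD1 mem_Collect_eq of_nat_le_iff of_nat_numeral of_nat_power)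
      show "0 < real n" using n1 x by (smt (verit) real_sqrt_gt_zero)
    qed
    also have "\<dots> = tau n * ln 2" by (simp add: ln_realpow)
    also have "\<dots> \<le> real (tau n) * 1"
      using ln_le_minus_one[of "2::real"] by (intro mult_left_mono) auto
    finally have tau: "1 \<le> 2 * tau n / ln x" using lx by (simp add: field_simps)
    \<comment> \<open>The two terms of \<open>?g n\<close> have product at least 1, hence so has their sum.\<close>
    define a where "a = l * weight (3/2) S n"
    define b where "b = 2 / (l * ln x) * (tau n * weight (2/3) S n)"
    have "a * b = 2 * tau n / ln x * (weight (3/2) S n * weight (2/3) S n)"
      using l lx by (simp add: a_def b_def field_simps)
    also have "\<dots> \<ge> 1" using tau by (simp add: weight_inverse)
    finally have ab: "1 \<le> a * b" .
    have "a \<ge> 0" "b \<ge> 0" unfolding a_def b_def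
      using l lx by (auto intro!: mult_nonneg_nonneg weight_nonneg divide_nonneg_nonneg)
    \<comment> \<open>If \<open>b <= 1\<close> then \<open>a\<close> is at least
      \<open>a * b\<close>, hence at least 1; otherwise \<open>b\<close> alone exceeds 1.\<close>
    then have "1 \<le> a + b" using ab mult_left_le[of b a] by argo
    then show ?thesis by (simp add: a_def b_def)
  qed
  have "card ?P \<le> card (?J \<union> (?P - ?J))" using fin by (intro card_mono) auto
  also have "\<dots> \<le> card ?J + card (?P - ?J)" by (rule card_Un_le)
  finally have "real (card ?P) \<le> real (card ?J) + real (card (?P - ?J))" by linarith
  also have "real (card ?J) \<le> sqrt x"
    using x by (subst card_pos_le_real) auto
  also have "real (card (?P - ?J)) = (\<Sum>n\<in>?P - ?J. 1)" by simp
  also have "\<dots> \<le> (\<Sum>n\<in>?P - ?J. ?g n)" by (intro sum_mono g1)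
  also have "\<dots> \<le> (\<Sum>n\<in>?I. ?g n)" using sub nn by (intro sum_mono2) auto
  also have "\<dots> = l * summatory (weight (3/2) S) x
        + 2 / (l * ln x) * summatory (\<lambda>n. tau n * weight (2/3) S n) x"
    by (simp only: summatory_def sum.distrib sum_distrib_left)
  finally show ?thesis by simp
qed

section \<open>Density zero from the choice of \<open>S\<close> and \<open>l\<close>\<close>

theorem theorem1p1:
  shows "((\<lambda>x::real. real (card {n::nat. real n \<le> x \<and> phi_practical n}) / x) \<longlongrightarrow> 0) at_top"
proof (rule tendstoI)
  fix e :: real assume e: "e > 0"
  obtain S where S: "finite S" "\<And>p. p \<in> S \<Longrightarrow> prime (p::nat)" and
    AC: "(\<Prod>p\<in>S. 1 + (3/2 - 1) / real p)
      * (\<Prod>p\<in>S. 1 + (2/3 - 1) * (2 / real p - 1 / real p ^ 2)) < e ^ 2 / 32"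
    using ex_primes_weight_product_less[of "e ^ 2 / 32"] e by auto
  define A where "A = (\<Prod>p\<in>S. 1 + (3/2 - 1) / real p)"
  define C where "C = (\<Prod>p\<in>S. 1 + (2/3 - 1) * (2 / real p - 1 / real p ^ 2))"
  have A0: "A > 0" unfolding A_def by (intro prod_pos) (auto simp: add_pos_nonneg)
  \<comment> \<open>This makes \<open>l * A\<close> equal to \<open>e / 4\<close>. The bound
    \<open>e ^ 2 / 32\<close> on \<open>A * C\<close> then puts the other term below
    \<open>e / 4\<close>.\<close>
  define l where "l = e / (4 * A)"
  have l: "l > 0" using e A0 by (simp add: l_def)
  let ?G = "summatory (weight (3/2) S)" and ?T = "summatory (\<lambda>n. tau n * weight (2/3) S n)"
  have "((\<lambda>x. sqrt x / x + l * (?G x / x) + 2 / l * (?T x / (x * ln x))) \<longlongrightarrow> 0 + l * A + 2 / l * C) at_top"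
    unfolding A_def C_def
    by (intro tendsto_intros summatory_weight_asymp summatory_tau_weight_asymp S) real_asymp
  moreover have "0 + l * A + 2 / l * C < e"
  proof -
    have "2 / l * C = 8 * (A * C) / e" using e A0 by (simp add: l_def)
    also have "\<dots> < 8 * (e ^ 2 / 32) / e"
      using AC e by (intro divide_strict_right_mono mult_strict_left_mono) (auto simp: A_def C_def)
    also have "\<dots> = e / 4" using e by (simp add: power2_eq_square)
    finally show ?thesis using e A0 by (simp add: l_def)
  qed
  ultimately have "eventually (\<lambda>x. sqrt x / x + l * (?G x / x) + 2 / l * (?T x / (x * ln x)) < e) at_top"
    by (rule order_tendstoD)
  with eventually_gt_at_top[of 1]
  show "\<forall>\<^sub>F x in at_top. dist (real (card {n. real n \<le> x \<and> phi_practical n}) / x) 0 < e"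
  proof eventually_elim
    case (elim x)
    have "real (card {n. real n \<le> x \<and> phi_practical n}) / x
        \<le> (sqrt x + l * ?G x + 2 / (l * ln x) * ?T x) / x"
      using card_phi_practical_le[of x l S] elim l by (intro divide_right_mono) auto
    also have "\<dots> = sqrt x / x + l * (?G x / x) + 2 / l * (?T x / (x * ln x))"
      using elim l by (simp add: add_divide_distrib)
    finally show ?case using elim by simp
  qed
qed

end
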